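(* Let $V$ be a finite nonempty set. A ternary relation $\mathcal{C}$ on $V$ is a tree betweenness if and only if it satisfies all of the following conditions: $(T_1)$ for all $u,v,w\in V$: $(u,v,w)\in\mathcal{C}$ implies $(w,v,u)\in\mathcal{C}$; $(T_2)$ for all $u,v,w,z\in V$: $(u,v,w)\in\mathcal{C}$, $(v,w,z)\in\mathcal{C}$ and $v\neq w$ imply $(u,w,z)\in\mathcal{C}$; $(T_3)$ for all $u,v,w,z\in V$: $(u,v,w)\in\mathcal{C}$ and $(u,w,z)\in\mathcal{C}$ imply $(v,w,z)\in\mathcal{C}$; $(T_4)$ for all $u,v,w\in V$: $N(u,v,w)$ implies that there exists $c\in V$ such that $c\neq u$, $(u,c,v)\in\mathcal{C}$ and $(u,c,w)\in\mathcal{C}$; $(T_5)$ for all $u,v,w\in V$: both $(u,v,w)\in\mathcal{C}$ and $(v,u,w)\in\mathcal{C}$ hold if and only if $u=v$.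
   Context: A tree is a finite, simple, undirected, connected graph without cycles. A ternary relation on a set $V$ is a subset of $V^3$. The tree betweenness of a tree $T$ is the set of all ordered triples $(x,y,z)$ such that $x,y,z$ are (not necessarily distinct) vertices of $T$ and $y$ belongs to the path in $T$ that joins $x$ and $z$ (the path includes its endpoints $x$ and $z$; if $x=z$ it consists of the single vertex $x$). A ternary relation on $V$ is a tree betweenness if it is the tree betweenness of some tree with vertex set $V$. Given the ternary relation $\mathcal{C}$ on $V$, $N(u,v,w)$ means that $u,v,w$ are pairwise distinct elements of $V$ and $(u,v,w)\notin\mathcal{C}$, $(v,w,u)\notin\mathcal{C}$, $(w,u,v)\notin\mathcal{C}$. *)

theory Defs
  imports "Graph_Theory.Digraph_Component"
begin

text \<open>
  The locale \<open>pair_graph\<close> describes finite simple undirected graphs, an edge being a pair of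
  mutually inverse arcs. Going back and forth along an edge is then a \<open>cycle\<close> of length 2, so
  the library predicate \<open>tree\<close> fails for every such graph that has an edge. The cycles of the
  undirected graph are the directed ones of length at least 3.
\<close>

definition graph_tree :: "'a pair_pre_digraph \<Rightarrow> bool" where
  "graph_tree T \<longleftrightarrow> pair_graph T \<and> connected (with_proj T) \<and>
     \<not> (\<exists>p. pre_digraph.cycle (with_proj T) p \<and> length p \<ge> 3)"

text \<open>
  In a tree there is exactly one path from \<open>x\<close> to \<open>z\<close>. The relation \<open>apath\<close> requires its
  endpoints to be vertices, and \<open>awalk_verts\<close> includes both of them; the path from \<open>x\<close> to \<open>x\<close>
  is the empty arc list, with vertex list \<open>[x]\<close>.
\<close>

definition betweenness_of :: "'a pair_pre_digraph \<Rightarrow> ('a \<times> 'a \<times> 'a) set" where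
  "betweenness_of T = {(x, y, z). \<exists>p. pre_digraph.apath (with_proj T) x p z \<and>
     y \<in> set (pre_digraph.awalk_verts (with_proj T) x p)}"

definition tree_betweenness :: "'a set \<Rightarrow> ('a \<times> 'a \<times> 'a) set \<Rightarrow> bool" where
  "tree_betweenness V C \<longleftrightarrow> (\<exists>T. graph_tree T \<and> pverts T = V \<and> C = betweenness_of T)"

definition noncollinear :: "'a set \<Rightarrow> ('a \<times> 'a \<times> 'a) set \<Rightarrow> 'a \<Rightarrow> 'a \<Rightarrow> 'a \<Rightarrow> bool" where
  "noncollinear V C u v w \<longleftrightarrow> u \<in> V \<and> v \<in> V \<and> w \<in> V \<and> u \<noteq> v \<and> v \<noteq> w \<and> u \<noteq> w \<and>
     (u, v, w) \<notin> C \<and> (v, w, u) \<notin> C \<and> (w, u, v) \<notin> C"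

end

(*
  In a tree, y lies on the path from x to z iff y is one of x, z or every walk from x to z passes
  through y. Conditions T1, T2, T3 and T5 hold for this separation relation in any connected graph.
  For T4, if u is not between v and w, the neighbour of u on the path to v is also the neighbour of u
  on the path to w, since otherwise there would be a cycle through u.

  Conversely, join u and v by an edge when nothing lies strictly between them. Splitting intervals at
  inner points joins u to w by a walk that stays between u and w, so a vertex not between u and w
  does not separate them. For fixed y, the relation "y is not between a and b" is transitive on V - {y}: it
  says that some d other than y lies both between y and a and between y and b, and the points
  between y and b form a chain. Hence a walk avoiding y never gets to the other side of y, so the
  vertices between u and w do separate them. If two neighbours of u are joined by a walk avoiding u,
  then they share some d other than u between them and u, and so both are equal to d.
*)
theory Submission
  imports Defs
begin

section \<open>Separation in a symmetric relation\<close>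

definition avoid :: "'a rel \<Rightarrow> 'a \<Rightarrow> 'a rel" where
  "avoid E y = E \<inter> (- {y}) \<times> (- {y})"

text \<open>The endpoint cases are explicit because of \<open>x = y = z\<close>: there the reflexive
  closure contains \<open>(y, y)\<close> although \<open>y\<close> lies on the trivial path.\<close>

definition separates :: "'a rel \<Rightarrow> 'a \<Rightarrow> 'a \<Rightarrow> 'a \<Rightarrow> bool" where
  "separates E x y z \<longleftrightarrow> y = x \<or> y = z \<or> (x, z) \<notin> (avoid E y)\<^sup>*"

text \<open>For symmetric \<open>E\<close>, a circuit through \<open>u\<close> of length at least 3 amounts to two distinct neighbours of
  \<open>u\<close> that are joined by a walk avoiding \<open>u\<close>.\<close>

definition circuit_free :: "'a rel \<Rightarrow> bool" where
  "circuit_free E \<longleftrightarrow> (\<forall>u c d. (u, c) \<in> E \<and> (u, d) \<in> E \<and> (c, d) \<in> (avoid E u)\<^sup>* \<longrightarrow> c = d)"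

lemma avoid_iff: "(a, b) \<in> avoid E y \<longleftrightarrow> (a, b) \<in> E \<and> a \<noteq> y \<and> b \<noteq> y"
  by (auto simp: avoid_def)

lemma sym_avoid: "sym E \<Longrightarrow> sym (avoid E y)"
  by (auto simp: sym_def avoid_iff)

lemma rtrancl_symD: "sym R \<Longrightarrow> (a, b) \<in> R\<^sup>* \<Longrightarrow> (b, a) \<in> R\<^sup>*"
  by (meson sym_rtrancl symD)

text \<open>Follow a walk from \<open>u\<close> to \<open>w\<close> until it first meets
  \<open>v\<close> or \<open>w\<close>; that initial part misses the other one.\<close>

lemma rtrancl_avoid_first:
  assumes "v \<noteq> w" "(u, w) \<in> E\<^sup>*"
  shows "(u, w) \<in> (avoid E v)\<^sup>* \<or> (u, v) \<in> (avoid E w)\<^sup>*"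
  using assms(2)
proof (induction rule: converse_rtrancl_induct)
  case base
  show ?case by simp
next
  case (step u u')
  show ?case
  proof (cases "u = v \<or> u = w")
    case True
    then show ?thesis by auto
  next
    case False
    with step assms(1) have "u' \<noteq> v \<Longrightarrow> (u, u') \<in> avoid E v" "u' \<noteq> w \<Longrightarrow> (u, u') \<in> avoid E w"
      by (auto simp: avoid_iff)
    with step.IH assms(1) show ?thesis
      by (metis converse_rtrancl_into_rtrancl rtrancl.rtrancl_refl)
  qed
qed

text \<open>Cut the walk at its last visit to \<open>u\<close>; the vertex that follows is
  \<open>c\<close>.\<close>

lemma rtrancl_last_exit:
  assumes "(u, v) \<in> E\<^sup>*" "u \<noteq> v"
  obtains c where "(u, c) \<in> E" "(c, v) \<in> (avoid E u)\<^sup>*"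
proof -
  have "u = v \<or> (\<exists>c. (u, c) \<in> E \<and> (c, v) \<in> (avoid E u)\<^sup>*)"
    using assms(1)
  proof (induction rule: rtrancl_induct)
    case base
    show ?case by simp
  next
    case (step a b)
    show ?case
    proof (cases "b = u \<or> a = u")
      case True
      with step show ?thesis by auto
    next
      case False
      with step have "(a, b) \<in> avoid E u" by (auto simp: avoid_iff)
      with step False show ?thesis by (meson rtrancl_into_rtrancl)
    qed
  qed
  with assms(2) that show ?thesis by blast
qed

lemma avoid_mono: "E \<subseteq> F \<Longrightarrow> avoid E y \<subseteq> avoid F y"
  by (auto simp: avoid_def)

lemma avoid_subset: "avoid E y \<subseteq> E"
  by (auto simp: avoid_def)

text \<open>Of the axioms \<open>T\<^sub>1\<close>--\<open>T\<^sub>5\<close>, only \<open>T\<^sub>4\<close> needs acyclicity; the others hold for separation in any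
  connected graph.\<close>

lemma separates_commute: "sym E \<Longrightarrow> separates E x y z \<longleftrightarrow> separates E z y x"
  unfolding separates_def by (meson rtrancl_symD sym_avoid)

lemma separates_self: "separates E x y x \<longleftrightarrow> y = x"
  by (auto simp: separates_def)

text \<open>A walk from \<open>w\<close> to \<open>u\<close> meets one of \<open>u\<close>,
  \<open>v\<close> first, and so reaches it without passing through the other.\<close>

lemma separates_antisym:
  assumes "sym E" "(u, w) \<in> E\<^sup>*" "separates E u v w" "separates E v u w"
  shows "u = v"
proof (rule ccontr)
  assume "u \<noteq> v"
  have "(w, u) \<in> E\<^sup>*"
    using assms(1,2) by (rule rtrancl_symD)
  with \<open>u \<noteq> v\<close> have "(w, u) \<in> (avoid E v)\<^sup>* \<or> (w, v) \<in> (avoid E u)\<^sup>*"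
    by (metis rtrancl_avoid_first)
  then have "(u, w) \<in> (avoid E v)\<^sup>* \<or> (v, w) \<in> (avoid E u)\<^sup>*"
    by (meson rtrancl_symD sym_avoid assms(1))
  with assms(3,4) \<open>u \<noteq> v\<close> show False by (auto simp: separates_def)
qed

text \<open>A walk from \<open>u\<close> to \<open>w\<close> meets \<open>v\<close> before
  \<open>w\<close>, so \<open>u\<close> and \<open>v\<close> are joined off \<open>w\<close>. A walk
  from \<open>u\<close> to \<open>z\<close> off \<open>w\<close> would thus yield one from
  \<open>v\<close> to \<open>z\<close>.\<close>

lemma separates_outer:
  assumes "sym E" "(u, w) \<in> E\<^sup>*" "separates E u v w" "separates E v w z" "v \<noteq> w"
  shows "separates E u w z"
proof (rule ccontr)
  assume "\<not> separates E u w z"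
  then have *: "w \<noteq> u" "w \<noteq> z" "(u, z) \<in> (avoid E w)\<^sup>*"
    by (auto simp: separates_def)
  have "(u, v) \<in> (avoid E w)\<^sup>*"
    using rtrancl_avoid_first[OF assms(5,2)] assms(3,5) by (auto simp: separates_def)
  then have "(v, z) \<in> (avoid E w)\<^sup>*"
    using * by (meson rtrancl_symD sym_avoid assms(1) rtrancl_trans)
  with assms(4,5) * show False by (auto simp: separates_def)
qed

lemma separates_inner:
  assumes "(u, w) \<in> E\<^sup>*" "separates E u v w" "separates E u w z"
  shows "separates E v w z"
proof (rule ccontr)
  assume "\<not> separates E v w z"
  then have *: "v \<noteq> w" "w \<noteq> z" "(v, z) \<in> (avoid E w)\<^sup>*"
    by (auto simp: separates_def)
  have "(u, v) \<in> (avoid E w)\<^sup>*"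
    using rtrancl_avoid_first[OF *(1) assms(1)] assms(2) *(1) by (auto simp: separates_def)
  then have "(u, z) \<in> (avoid E w)\<^sup>*"
    using * by (meson rtrancl_trans)
  with assms(3) * have "u = w" by (auto simp: separates_def)
  with assms(2) *(1) show False by (simp add: separates_self)
qed

text \<open>Otherwise a walk from \<open>u\<close> to \<open>v\<close> that misses \<open>c\<close>
  would leave \<open>u\<close> through some \<open>d\<close> other than \<open>c\<close>, and
  \<open>c\<close> and \<open>d\<close> would be joined off \<open>u\<close> by way of
  \<open>v\<close>.\<close>

lemma neighbour_separates:
  assumes "sym E" "circuit_free E" "(u, c) \<in> E" "(c, v) \<in> (avoid E u)\<^sup>*" "u \<noteq> v"
  shows "separates E u c v"
proof (rule ccontr)
  assume "\<not> separates E u c v"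
  then have *: "c \<noteq> u" "c \<noteq> v" "(u, v) \<in> (avoid E c)\<^sup>*"
    by (auto simp: separates_def)
  obtain d where d: "(u, d) \<in> avoid E c" "(d, v) \<in> (avoid (avoid E c) u)\<^sup>*"
    using rtrancl_last_exit[OF *(3) assms(5)] .
  from d(2) have "(d, v) \<in> (avoid E u)\<^sup>*"
    by (meson rtrancl_mono avoid_mono avoid_subset subsetD)
  with assms(4) have "(c, d) \<in> (avoid E u)\<^sup>*"
    by (meson rtrancl_symD sym_avoid assms(1) rtrancl_trans)
  with assms(2,3) d(1) have "c = d"
    by (auto simp: circuit_free_def avoid_iff)
  with d(1) show False by (simp add: avoid_iff)
qed

text \<open>This is T4: the neighbour of \<open>u\<close> towards \<open>v\<close> also leads to
  \<open>w\<close>, since \<open>v\<close> and \<open>w\<close> are joined off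
  \<open>u\<close>.\<close>

lemma separates_branch:
  assumes "sym E" "circuit_free E" "(u, v) \<in> E\<^sup>*" "\<not> separates E w u v"
  obtains c where "(u, c) \<in> E" "separates E u c v" "separates E u c w"
proof -
  from assms(4) have *: "u \<noteq> w" "u \<noteq> v" "(w, v) \<in> (avoid E u)\<^sup>*"
    by (auto simp: separates_def)
  obtain c where c: "(u, c) \<in> E" "(c, v) \<in> (avoid E u)\<^sup>*"
    using rtrancl_last_exit[OF assms(3) *(2)] .
  then have "(c, w) \<in> (avoid E u)\<^sup>*"
    using *(3) by (meson rtrancl_symD sym_avoid assms(1) rtrancl_trans)
  with c * show ?thesis
    using that neighbour_separates[OF assms(1,2) c(1)] by blast
qed

section \<open>Trees\<close>

context pair_wf_digraph
begin

lemma avoid_awalk: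
  assumes "awalk x p z" "y \<notin> set (pawalk_verts x p)"
  shows "(x, z) \<in> (avoid (parcs G) y)\<^sup>*"
  using assms
proof (induction p arbitrary: x)
  case Nil
  then show ?case by (simp add: awalk_Nil_iff)
next
  case (Cons e p)
  then have "awalk (snd e) p z" "snd e \<in> set (pawalk_verts (snd e) p)"
    by (auto simp: awalk_Cons_iff hd_in_awalk_verts)
  with Cons have "(x, snd e) \<in> avoid (parcs G) y" "(snd e, z) \<in> (avoid (parcs G) y)\<^sup>*"
    by (cases e; force simp: awalk_Cons_iff avoid_iff)+
  then show ?case by (rule converse_rtrancl_into_rtrancl)
qed

text \<open>\<open>R\<close> is left open to keep track of the arcs used: \<open>parcs G\<close>
  gives arbitrary walks, \<open>avoid (parcs G) y\<close> gives walks that miss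
  \<open>y\<close>.\<close>

lemma awalk_rtrancl:
  assumes "(x, z) \<in> R\<^sup>*" "R \<subseteq> parcs G" "x \<in> pverts G"
  obtains p where "awalk x p z" "set p \<subseteq> R"
proof -
  have "\<exists>p. awalk x p z \<and> set p \<subseteq> R"
    using assms(1,3)
  proof (induction rule: converse_rtrancl_induct)
    case base
    then have "awalk z [] z \<and> set [] \<subseteq> R"
      by (simp add: awalk_Nil_iff)
    then show ?case ..
  next
    case (step a b)
    with assms(2) obtain p where "awalk b p z" "set p \<subseteq> R"
      using in_arcsD2 by blast
    with step assms(2) have "awalk a ((a, b) # p) z \<and> set ((a, b) # p) \<subseteq> R"
      by (auto simp: awalk_Cons_iff)
    then show ?case ..
  qed
  with that show ?thesis by blast
qed

lemma apath_rtrancl: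
  assumes "(x, z) \<in> R\<^sup>*" "R \<subseteq> parcs G" "x \<in> pverts G"
  obtains p where "apath x p z" "set p \<subseteq> R"
proof -
  obtain p where "awalk x p z" "set p \<subseteq> R"
    using awalk_rtrancl assms .
  then have "apath x (awalk_to_apath p) z" "set (awalk_to_apath p) \<subseteq> R"
    using apath_awalk_to_apath awalk_to_apath_subset by blast+
  with that show ?thesis .
qed

lemma avoid_apath:
  assumes "(x, z) \<in> (avoid (parcs G) y)\<^sup>*" "x \<in> pverts G" "x \<noteq> y"
  obtains p where "apath x p z" "y \<notin> set (pawalk_verts x p)"
proof -
  obtain p where p: "apath x p z" "set p \<subseteq> avoid (parcs G) y"
    using apath_rtrancl[OF assms(1) avoid_subset assms(2)] .
  from p assms(3) have "y \<notin> set (pawalk_verts x p)"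
    using set_awalk_verts[of x p z] by (auto simp: apath_def avoid_def)
  with p(1) that show ?thesis by blast
qed

end

section \<open>Acyclicity and connectedness in terms of the arc relation\<close>

lemma (in pair_sym_digraph) sym_parcs: "sym (parcs G)"
  using arcs_symmetric by (auto simp: sym_def)

text \<open>A path between two neighbours of \<open>u\<close> that misses \<open>u\<close> closes up
  through \<open>u\<close> to a cycle; conversely, removing \<open>u\<close> from a cycle leaves
  such a path.\<close>

lemma (in pair_graph) no_cycle_iff_circuit_free:
  "\<not> (\<exists>p. cycle p \<and> length p \<ge> 3) \<longleftrightarrow> circuit_free (parcs G)"
proof
  assume nc: "\<not> (\<exists>p. cycle p \<and> length p \<ge> 3)"
  show "circuit_free (parcs G)"
    unfolding circuit_free_def
  proof (intro allI impI, elim conjE, rule ccontr)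
    fix u c d
    assume uc: "(u, c) \<in> parcs G" and ud: "(u, d) \<in> parcs G"
      and cd: "(c, d) \<in> (avoid (parcs G) u)\<^sup>*" and "c \<noteq> d"
    have "c \<in> pverts G" "c \<noteq> u"
      using uc in_arcsD2 no_loops' by blast+
    then obtain p where p: "apath c p d" "u \<notin> set (pawalk_verts c p)"
      using avoid_apath[OF cd] by blast
    let ?q = "(u, c) # p @ [(d, u)]"
    have w: "awalk u ?q u"
      using p(1) uc ud arcs_symmetric
      by (auto simp: awalk_simps apath_def in_arcsD1)
    then have "pawalk_verts c (p @ [(d, u)]) = pawalk_verts c p @ [u]"
      using p(1) awalk_verts_append[of c p "[(d, u)]" u]
      by (auto simp: awalk_Cons_iff apath_def)
    then have "cycle ?q"
      unfolding cycle_def using w p by (intro exI[of _ u]) (auto simp: apath_def)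
    moreover have "p \<noteq> []"
      using p(1) \<open>c \<noteq> d\<close> by (auto simp: apath_Nil_iff)
    then have "length ?q \<ge> 3"
      by (cases p) auto
    ultimately show False using nc by blast
  qed
next
  assume cf: "circuit_free (parcs G)"
  show "\<not> (\<exists>p. cycle p \<and> length p \<ge> 3)"
  proof
    assume "\<exists>p. cycle p \<and> length p \<ge> 3"
    then obtain p u where p: "awalk u p u" "distinct (tl (pawalk_verts u p))" "length p \<ge> 3"
      by (auto simp: cycle_def)
    \<comment> \<open>Length at least 3 makes the middle part \<open>q\<close> nonempty; going back
      and forth along one edge would leave it empty.\<close>
    obtain e q f where q: "p = e # q @ [f]" "q \<noteq> []"
    proof (cases p)
      case (Cons e r)
      with p(3) that show ?thesis
        by (cases r rule: rev_cases) (auto simp: Suc_le_eq)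
    qed (use p(3) in auto)
    define c d where "c = snd e" and "d = fst f"
    have arcs: "e \<in> parcs G" "f \<in> parcs G" "fst e = u" "snd f = u" and w: "awalk c q d"
      using p(1) unfolding q(1) c_def d_def by (auto simp: awalk_simps)
    have "pawalk_verts c (q @ [f]) = pawalk_verts c q @ [u]"
      using awalk_verts_append[of c q "[f]" u] p(1) arcs(4) w
      unfolding q(1) c_def by (auto simp: awalk_simps)
    with p(2) have dist: "distinct (pawalk_verts c q)" "u \<notin> set (pawalk_verts c q)"
      by (auto simp: q(1) c_def)
    have "(c, d) \<in> (avoid (parcs G) u)\<^sup>*"
      using w dist(2) by (rule avoid_awalk)
    moreover have "(u, c) \<in> parcs G" "(u, d) \<in> parcs G"
      using arcs arcs_symmetric by (cases e; cases f; auto simp: c_def d_def)+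
    ultimately have "c = d"
      using cf unfolding circuit_free_def by blast
    with w dist(1) q(2) show False
      using apath_nonempty_ends by (auto simp: apath_def)
  qed
qed

text \<open>\<open>connected\<close> refers to the symmetrized graph, which has the same
  reachability because the arcs are already symmetric.\<close>

lemma (in pair_graph) connected_iff_rtrancl:
  "connected (with_proj G) \<longleftrightarrow>
    pverts G \<noteq> {} \<and> (\<forall>u\<in>pverts G. \<forall>v\<in>pverts G. (u, v) \<in> (parcs G)\<^sup>*)"
proof -
  have "u \<rightarrow>\<^sup>*\<^bsub>mk_symmetric (with_proj G)\<^esub> v \<longleftrightarrow> (u, v) \<in> (parcs G)\<^sup>*"
    if "u \<in> pverts G" for u v
  proof -
    have "u \<rightarrow>\<^sup>*\<^bsub>mk_symmetric (with_proj G)\<^esub> v \<longleftrightarrow> u \<rightarrow>\<^sup>*\<^bsub>with_proj G\<^esub> v"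
      by (rule reachable_mk_symmetric_eq[OF sym_arcs])
    also have "\<dots> \<longleftrightarrow> (\<exists>p. awalk u p v)"
      by (rule reachable_awalk)
    also have "\<dots> \<longleftrightarrow> (u, v) \<in> (parcs G)\<^sup>*"
    proof
      assume "\<exists>p. awalk u p v"
      then obtain p where "awalk u p v" ..
      then show "(u, v) \<in> (parcs G)\<^sup>*"
        by (induction p arbitrary: u) (auto simp: awalk_simps intro: converse_rtrancl_into_rtrancl)
    qed (use awalk_rtrancl[of u v "parcs G"] that in blast)
    finally show ?thesis .
  qed
  then show ?thesis
    by (auto simp: connected_def strongly_connected_def)
qed

text \<open>Both the path and a supposed walk to \<open>z\<close> that misses \<open>y\<close> leave
  \<open>x\<close> for the last time through a neighbour joined to \<open>z\<close> off
  \<open>x\<close>. Without circuits these neighbours coincide, and the rest of the walk contradicts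
  the induction hypothesis.\<close>

lemma (in pair_graph) apath_separates:
  assumes "circuit_free (parcs G)" "apath x p z" "y \<in> set (pawalk_verts x p)"
  shows "separates (parcs G) x y z"
  using assms(2,3)
proof (induction p arbitrary: x)
  case Nil
  then show ?case by (simp add: separates_def)
next
  case (Cons e p)
  define x' where "x' = snd e"
  have e: "(x, x') \<in> parcs G" "apath x' p z" "x \<notin> set (pawalk_verts x' p)"
    using Cons.prems(1) by (auto simp: apath_Cons_iff x'_def)
  show ?case
  proof (rule ccontr)
    assume "\<not> separates (parcs G) x y z"
    then have y: "y \<noteq> x" "y \<noteq> z" "(x, z) \<in> (avoid (parcs G) y)\<^sup>*"
      by (auto simp: separates_def)
    have "y \<in> set (pawalk_verts x' p)"
      using Cons.prems y(1) by (auto simp: x'_def apath_Cons_iff)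
    then have sep: "separates (parcs G) x' y z"
      using Cons.IH e(2) by blast
    have "x \<noteq> z"
      using apath_nonempty_ends[OF Cons.prems(1)] by simp
    \<comment> \<open>The last exit is taken inside \<open>avoid (parcs G) y\<close>, so
      \<open>c\<close> differs from \<open>y\<close> and the remaining walk misses both
      \<open>x\<close> and \<open>y\<close>.\<close>
    then obtain c where c: "(x, c) \<in> avoid (parcs G) y" "(c, z) \<in> (avoid (avoid (parcs G) y) x)\<^sup>*"
      using rtrancl_last_exit[OF y(3)] by blast
    have cz: "(c, z) \<in> (avoid (parcs G) x)\<^sup>*" "(c, z) \<in> (avoid (parcs G) y)\<^sup>*"
      using c(2) by (meson rtrancl_mono avoid_mono avoid_subset subsetD)+
    have "(x', z) \<in> (avoid (parcs G) x)\<^sup>*"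
      using e by (intro avoid_awalk) (auto simp: apath_def)
    then have "(x', c) \<in> (avoid (parcs G) x)\<^sup>*"
      using cz(1) by (meson rtrancl_symD sym_avoid sym_parcs rtrancl_trans)
    then have "x' = c"
      using assms(1) e(1) c(1) unfolding circuit_free_def by (auto simp: avoid_iff)
    with cz(2) sep c(1) y(2) show False
      by (auto simp: separates_def avoid_iff)
  qed
qed

text \<open>Vertices of a path separate its ends by acyclicity, and every path passes through each
  separating vertex. From here on separation replaces paths.\<close>

lemma betweenness_of_tree:
  assumes "graph_tree T"
  shows "betweenness_of T =
    {(x, y, z). x \<in> pverts T \<and> y \<in> pverts T \<and> z \<in> pverts T \<and> separates (parcs T) x y z}"
proof -
  interpret pair_graph T
    using assms by (simp add: graph_tree_def)
  have cf: "circuit_free (parcs T)"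
    using assms no_cycle_iff_circuit_free by (simp add: graph_tree_def)
  have conn: "(u, v) \<in> (parcs T)\<^sup>*" if "u \<in> pverts T" "v \<in> pverts T" for u v
    using assms connected_iff_rtrancl that by (simp add: graph_tree_def)
  have "(\<exists>p. apath x p z \<and> y \<in> set (pawalk_verts x p)) \<longleftrightarrow>
      x \<in> pverts T \<and> y \<in> pverts T \<and> z \<in> pverts T \<and> separates (parcs T) x y z" for x y z
  proof
    assume "\<exists>p. apath x p z \<and> y \<in> set (pawalk_verts x p)"
    then show "x \<in> pverts T \<and> y \<in> pverts T \<and> z \<in> pverts T \<and> separates (parcs T) x y z"
      using apath_separates[OF cf] by (auto simp: apath_def)
  next
    assume *: "x \<in> pverts T \<and> y \<in> pverts T \<and> z \<in> pverts T \<and> separates (parcs T) x y z"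
    then obtain p where p: "apath x p z"
      using apath_rtrancl[OF conn order_refl] by blast
    then have "x \<in> set (pawalk_verts x p)" "z \<in> set (pawalk_verts x p)"
      by (auto simp: apath_def dest: hd_in_awalk_verts)
    then have "y \<in> set (pawalk_verts x p)"
      using * p avoid_awalk[of x p z y] by (auto simp: separates_def apath_def)
    with p show "\<exists>p. apath x p z \<and> y \<in> set (pawalk_verts x p)" by blast
  qed
  then show ?thesis
    by (auto simp: betweenness_of_def awalk_verts_with_proj_eq)
qed

section \<open>The axioms\<close>

text \<open>By \<open>C_subset\<close> a triple in \<open>C\<close> brings its own membership in
  \<open>V\<close>, so bounds appear only where no such triple is given. T5 is split into
  \<open>refl\<close> and \<open>antisym\<close>.\<close>

locale between =
  fixes V :: "'a set" and C :: "('a \<times> 'a \<times> 'a) set"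
  assumes finite_V: "finite V" and C_subset: "C \<subseteq> V \<times> V \<times> V"
    and commute: "(u, v, w) \<in> C \<Longrightarrow> (w, v, u) \<in> C"
    and outer: "(u, v, w) \<in> C \<Longrightarrow> (v, w, z) \<in> C \<Longrightarrow> v \<noteq> w \<Longrightarrow> (u, w, z) \<in> C"
    and inner: "(u, v, w) \<in> C \<Longrightarrow> (u, w, z) \<in> C \<Longrightarrow> (v, w, z) \<in> C"
    and branch: "noncollinear V C u v w \<Longrightarrow> \<exists>c. c \<noteq> u \<and> (u, c, v) \<in> C \<and> (u, c, w) \<in> C"
    and refl: "u \<in> V \<Longrightarrow> w \<in> V \<Longrightarrow> (u, u, w) \<in> C"
    and antisym: "(u, v, w) \<in> C \<Longrightarrow> (v, u, w) \<in> C \<Longrightarrow> u = v"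
begin

lemma in_V: "(u, v, w) \<in> C \<Longrightarrow> u \<in> V \<and> v \<in> V \<and> w \<in> V"
  using C_subset by auto

lemma refl2: "u \<in> V \<Longrightarrow> w \<in> V \<Longrightarrow> (u, w, w) \<in> C"
  by (simp add: commute refl)

lemma self: "(u, v, u) \<in> C \<Longrightarrow> v = u"
  using antisym[of u v u] refl2 in_V by blast

lemma antisym2: "(u, v, w) \<in> C \<Longrightarrow> (u, w, v) \<in> C \<Longrightarrow> v = w"
  using antisym commute by blast

text \<open>T3 gives \<open>(v, w, z)\<close>; read from \<open>z\<close>, T2 then prolongs the
  triple beyond \<open>v\<close> to \<open>u\<close>.\<close>

lemma trans:
  assumes "(u, v, w) \<in> C" "(u, w, z) \<in> C"
  shows "(u, v, z) \<in> C"
proof (cases "v = w")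
  case False
  have "(z, w, v) \<in> C" "(w, v, u) \<in> C"
    using assms inner commute by blast+
  with False show ?thesis
    using outer commute by blast
qed (use assms in simp)

section \<open>Intervals and their size\<close>

definition interval :: "'a \<Rightarrow> 'a \<Rightarrow> 'a set" where
  "interval u w = {v. (u, v, w) \<in> C}"

lemma finite_interval: "finite (interval u w)"
  by (rule finite_subset[OF _ finite_V]) (auto simp: interval_def dest: in_V)

text \<open>Each part of a split interval lies in the whole and misses its far end. This is the
  measure for the inductions in \<open>chain\<close> and \<open>rtrancl_edges\<close>.\<close>

lemma card_interval_less:
  assumes "(u, v, w) \<in> C"
  shows "v \<noteq> w \<Longrightarrow> card (interval u v) < card (interval u w)"
    and "v \<noteq> u \<Longrightarrow> card (interval v w) < card (interval u w)"
proof -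
  have "interval u v \<subseteq> interval u w" "interval v w \<subseteq> interval u w"
    unfolding interval_def using assms trans commute by blast+
  moreover have "w \<in> interval u w" "u \<in> interval u w"
    using assms in_V refl refl2 by (auto simp: interval_def)
  moreover have "w \<notin> interval u v" if "v \<noteq> w"
    using assms that antisym2 by (auto simp: interval_def)
  moreover have "u \<notin> interval v w" if "v \<noteq> u"
    using assms that antisym by (auto simp: interval_def)
  ultimately show "v \<noteq> w \<Longrightarrow> card (interval u v) < card (interval u w)"
    and "v \<noteq> u \<Longrightarrow> card (interval v w) < card (interval u w)"
    by (metis finite_interval psubsetI psubset_card_mono)+
qed

text \<open>Two incomparable points \<open>d\<close>, \<open>e\<close> would branch, by \<open>T\<^sub>4\<close>, at some \<open>c \<noteq> y\<close>, and would still be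
  incomparable as seen from \<open>c\<close> in the smaller interval from \<open>c\<close> to \<open>b\<close>.\<close>
lemma chain:
  assumes "(y, d, b) \<in> C" "(y, e, b) \<in> C"
  shows "(y, d, e) \<in> C \<or> (y, e, d) \<in> C"
  using assms
proof (induction "card (interval y b)" arbitrary: y rule: less_induct)
  case less
  note d = less.prems(1) and e = less.prems(2)
  show ?case
  proof (rule ccontr)
    assume neg: "\<not> ?thesis"
    have V: "y \<in> V" "d \<in> V" "e \<in> V"
      using d e in_V by blast+
    have neq: "y \<noteq> d" "y \<noteq> e" "d \<noteq> e"
      using neg V refl refl2 by blast+
    \<comment> \<open>With \<open>y\<close> between \<open>d\<close> and \<open>e\<close>, T2 would
      put \<open>e\<close> between \<open>d\<close> and \<open>b\<close>, and \<open>d\<close>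
      between \<open>e\<close> and \<open>b\<close>.\<close>
    have "(d, y, e) \<notin> C"
    proof
      assume "(d, y, e) \<in> C"
      then have "(d, e, b) \<in> C" "(e, d, b) \<in> C"
        using outer d e neq commute by blast+
      with neq show False using antisym by blast
    qed
    then have "noncollinear V C y d e"
      unfolding noncollinear_def using V neq neg commute by blast
    then obtain c where c: "c \<noteq> y" "(y, c, d) \<in> C" "(y, c, e) \<in> C"
      using branch by blast
    have "(y, c, b) \<in> C"
      using c(2) d by (rule trans)
    then have "card (interval c b) < card (interval y b)"
      using c(1) by (rule card_interval_less(2))
    moreover have "(c, d, b) \<in> C" "(c, e, b) \<in> C"
      using c d e inner by blast+
    ultimately have "(c, d, e) \<in> C \<or> (c, e, d) \<in> C"
      by (rule less.hyps)
    \<comment> \<open>Since \<open>c\<close> lies between \<open>y\<close> and each of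
      \<open>d\<close>, \<open>e\<close>, comparability seen from \<open>c\<close> carries over to
      \<open>y\<close>.\<close>
    then show False
      using c neg trans commute by blast
  qed
qed

section \<open>The sides of a vertex\<close>

text \<open>T4 supplies \<open>d\<close>, unless \<open>a\<close> or \<open>b\<close> itself serves.
  Conversely, with \<open>y\<close> between \<open>a\<close> and \<open>b\<close>, T3 would put
  \<open>y\<close> between \<open>d\<close> and \<open>b\<close>, against
  \<open>antisym\<close>.\<close>

lemma not_between_iff:
  assumes "a \<in> V" "b \<in> V" "y \<in> V" "a \<noteq> y" "b \<noteq> y"
  shows "(a, y, b) \<notin> C \<longleftrightarrow> (\<exists>d. d \<noteq> y \<and> (y, d, a) \<in> C \<and> (y, d, b) \<in> C)"
proof
  assume "(a, y, b) \<notin> C"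
  show "\<exists>d. d \<noteq> y \<and> (y, d, a) \<in> C \<and> (y, d, b) \<in> C"
  proof (cases "(y, a, b) \<in> C \<or> (y, b, a) \<in> C")
    case True
    with assms refl2 show ?thesis by blast
  next
    case False
    then have "noncollinear V C y a b"
      unfolding noncollinear_def using assms \<open>(a, y, b) \<notin> C\<close> commute refl2 by blast
    then show ?thesis by (rule branch)
  qed
next
  assume "\<exists>d. d \<noteq> y \<and> (y, d, a) \<in> C \<and> (y, d, b) \<in> C"
  then obtain d where d: "d \<noteq> y" "(y, d, a) \<in> C" "(y, d, b) \<in> C" by blast
  show "(a, y, b) \<notin> C"
  proof
    assume "(a, y, b) \<in> C"
    with d have "(d, y, b) \<in> C"
      using inner commute by blast
    with d show False using antisym by blast
  qed
qed

text \<open>The witnesses for both pairs lie between \<open>y\<close> and \<open>b\<close>, so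
  \<open>chain\<close> compares them; the one nearer to \<open>y\<close> serves for \<open>a\<close>
  and \<open>c\<close>.\<close>

lemma not_between_trans:
  assumes "b \<in> V" "(a, y, b) \<notin> C" "(b, y, c) \<notin> C" "b \<noteq> y"
  shows "(a, y, c) \<notin> C"
proof
  assume ayc: "(a, y, c) \<in> C"
  then have V: "a \<in> V" "y \<in> V" "c \<in> V"
    using in_V by blast+
  have ne: "a \<noteq> y" "c \<noteq> y"
    using assms V refl refl2 by blast+
  obtain d where d: "d \<noteq> y" "(y, d, a) \<in> C" "(y, d, b) \<in> C"
    using not_between_iff assms(1,2,4) V ne by blast
  obtain e where e: "e \<noteq> y" "(y, e, b) \<in> C" "(y, e, c) \<in> C"
    using not_between_iff assms(1,3,4) V ne by blast
  have "(y, d, e) \<in> C \<or> (y, e, d) \<in> C"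
    using d(3) e(2) by (rule chain)
  then have "\<exists>f. f \<noteq> y \<and> (y, f, a) \<in> C \<and> (y, f, c) \<in> C"
    using d e trans by blast
  with ayc show False
    using not_between_iff V ne by blast
qed

section \<open>The tree built from the axioms\<close>

definition edges :: "'a rel" where
  "edges = {(u, v). u \<in> V \<and> v \<in> V \<and> u \<noteq> v \<and> interval u v \<subseteq> {u, v}}"

lemma sym_edges: "sym edges"
  using commute by (auto simp: sym_def edges_def interval_def)

text \<open>Split at an inner point and recurse. The set \<open>S\<close> lets one induction serve
  twice: \<open>UNIV\<close> gives connectedness, \<open>- {y}\<close> gives walks that miss
  \<open>y\<close>.\<close>

lemma rtrancl_edges:
  assumes "u \<in> V" "w \<in> V" "interval u w \<subseteq> S"
  shows "(u, w) \<in> (edges \<inter> S \<times> S)\<^sup>*"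
  using assms
proof (induction "card (interval u w)" arbitrary: u w rule: less_induct)
  case less
  note uw = less.prems
  show ?case
  proof (cases "u = w \<or> (u, w) \<in> edges")
    case True
    moreover have "u \<in> S" "w \<in> S"
      using uw refl refl2 by (auto simp: interval_def)
    ultimately show ?thesis by auto
  next
    case False
    with uw obtain v where v: "(u, v, w) \<in> C" "v \<noteq> u" "v \<noteq> w"
      by (auto simp: edges_def interval_def)
    have "interval u v \<subseteq> S" "interval v w \<subseteq> S" "v \<in> V"
      using v(1) uw(3) trans commute in_V unfolding interval_def by blast+
    then have "(u, v) \<in> (edges \<inter> S \<times> S)\<^sup>*" "(v, w) \<in> (edges \<inter> S \<times> S)\<^sup>*"
      using less.hyps card_interval_less[OF v(1)] v uw by blast+
    then show ?thesis by (rule rtrancl_trans)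
  qed
qed

text \<open>An edge that misses \<open>y\<close> has nothing but its ends between them, so each step
  stays on the same side of \<open>y\<close>.\<close>

lemma rtrancl_avoid_edges_not_between:
  assumes "(a, b) \<in> (avoid edges y)\<^sup>*" "a \<noteq> y"
  shows "(a, y, b) \<notin> C"
  using assms(1)
proof (induction rule: rtrancl_induct)
  case base
  show ?case using self assms(2) by blast
next
  case (step b c)
  then have "b \<in> V" "b \<noteq> y" "(b, y, c) \<notin> C"
    by (auto simp: avoid_iff edges_def interval_def)
  with step.IH show ?case
    using not_between_trans by blast
qed

lemma separates_edges_iff:
  assumes "x \<in> V" "y \<in> V" "z \<in> V"
  shows "separates edges x y z \<longleftrightarrow> (x, y, z) \<in> C"
proof
  assume sep: "separates edges x y z"
  show "(x, y, z) \<in> C"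
  proof (rule ccontr)
    assume "(x, y, z) \<notin> C"
    \<comment> \<open>The interval from \<open>x\<close> to \<open>z\<close> misses
      \<open>y\<close>, and \<open>edges\<close> restricted to \<open>- {y}\<close> is
      \<open>avoid edges y\<close>.\<close>
    then have "(x, z) \<in> (avoid edges y)\<^sup>*" "y \<noteq> x" "y \<noteq> z"
      unfolding avoid_def using assms refl refl2
      by (auto intro!: rtrancl_edges simp: interval_def)
    with sep show False by (simp add: separates_def)
  qed
next
  assume "(x, y, z) \<in> C"
  then show "separates edges x y z"
    unfolding separates_def using rtrancl_avoid_edges_not_between by blast
qed

lemma circuit_free_edges: "circuit_free edges"
  unfolding circuit_free_def
proof (intro allI impI, elim conjE)
  fix u c d
  assume uc: "(u, c) \<in> edges" and ud: "(u, d) \<in> edges" and cd: "(c, d) \<in> (avoid edges u)\<^sup>*"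
  then have V: "u \<in> V" "c \<in> V" "d \<in> V" "c \<noteq> u" "d \<noteq> u"
    by (auto simp: edges_def)
  then have "(c, u, d) \<notin> C"
    using cd rtrancl_avoid_edges_not_between by blast
  then obtain e where "e \<noteq> u" "(u, e, c) \<in> C" "(u, e, d) \<in> C"
    using not_between_iff V by blast
  with uc ud show "c = d"
    by (auto simp: edges_def interval_def)
qed

lemma tree_betweenness:
  assumes "V \<noteq> {}"
  shows "tree_betweenness V C"
proof -
  let ?T = "\<lparr>pverts = V, parcs = edges\<rparr>"
  interpret T: pair_graph ?T
  proof
    show "finite (parcs ?T)"
      by (rule finite_subset[OF _ finite_cartesian_product[OF finite_V finite_V]])
        (auto simp: edges_def)
  qed (use finite_V sym_edges in \<open>auto simp: edges_def symmetric_def\<close>)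
  have "(u, v) \<in> edges\<^sup>*" if "u \<in> V" "v \<in> V" for u v
    using rtrancl_edges[of u v UNIV] that by simp
  then have tree: "graph_tree ?T"
    unfolding graph_tree_def
    using T.pair_graph T.no_cycle_iff_circuit_free T.connected_iff_rtrancl circuit_free_edges assms
    by auto
  moreover have "C = betweenness_of ?T"
    unfolding betweenness_of_tree[OF tree] using separates_edges_iff in_V by auto
  ultimately show ?thesis
    unfolding tree_betweenness_def by (intro exI[of _ ?T]) simp
qed

end

theorem corollary5:
  fixes V :: "'a set" and C :: "('a \<times> 'a \<times> 'a) set"
  assumes "finite V" and "V \<noteq> {}" and "C \<subseteq> V \<times> V \<times> V"
  shows "tree_betweenness V C \<longleftrightarrow>
    (\<forall>u\<in>V. \<forall>v\<in>V. \<forall>w\<in>V. (u, v, w) \<in> C \<longrightarrow> (w, v, u) \<in> C) \<and>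
    (\<forall>u\<in>V. \<forall>v\<in>V. \<forall>w\<in>V. \<forall>z\<in>V. (u, v, w) \<in> C \<and> (v, w, z) \<in> C \<and> v \<noteq> w \<longrightarrow> (u, w, z) \<in> C) \<and>
    (\<forall>u\<in>V. \<forall>v\<in>V. \<forall>w\<in>V. \<forall>z\<in>V. (u, v, w) \<in> C \<and> (u, w, z) \<in> C \<longrightarrow> (v, w, z) \<in> C) \<and>
    (\<forall>u\<in>V. \<forall>v\<in>V. \<forall>w\<in>V. noncollinear V C u v w \<longrightarrow>
       (\<exists>c\<in>V. c \<noteq> u \<and> (u, c, v) \<in> C \<and> (u, c, w) \<in> C)) \<and>
    (\<forall>u\<in>V. \<forall>v\<in>V. \<forall>w\<in>V. (u, v, w) \<in> C \<and> (v, u, w) \<in> C \<longleftrightarrow> u = v)"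
    (is "_ \<longleftrightarrow> ?axioms")
proof
  assume "tree_betweenness V C"
  then obtain T where T: "graph_tree T" "pverts T = V" and C: "C = betweenness_of T"
    unfolding tree_betweenness_def by blast
  define E where "E = parcs T"
  interpret pair_graph T
    using T(1) by (simp add: graph_tree_def)
  have sym: "sym E"
    unfolding E_def by (rule sym_parcs)
  have cf: "circuit_free E"
    using T(1) no_cycle_iff_circuit_free by (simp add: graph_tree_def E_def)
  have conn: "(u, v) \<in> E\<^sup>*" if "u \<in> V" "v \<in> V" for u v
    using T connected_iff_rtrancl that by (simp add: graph_tree_def E_def)
  have mem: "(x, y, z) \<in> C \<longleftrightarrow> separates E x y z" if "x \<in> V" "y \<in> V" "z \<in> V" for x y z
    using that T(2) by (simp add: C betweenness_of_tree[OF T(1)] E_def)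
  show ?axioms
  proof (intro conjI ballI impI)
    fix u v w assume V: "u \<in> V" "v \<in> V" "w \<in> V"
    show "(u, v, w) \<in> C \<Longrightarrow> (w, v, u) \<in> C"
      using V separates_commute[OF sym] by (simp add: mem)
    show "(u, v, w) \<in> C \<and> (v, u, w) \<in> C \<longleftrightarrow> u = v"
      unfolding mem[OF V] mem[OF V(2,1,3)]
      using separates_antisym[OF sym conn[OF V(1,3)]] separates_def by metis
    assume "noncollinear V C u v w"
    then have "\<not> separates E w u v"
      using V by (simp add: noncollinear_def mem)
    then obtain c where c: "(u, c) \<in> E" "separates E u c v" "separates E u c w"
      using separates_branch[OF sym cf conn] V by blast
    moreover have "c \<in> V" "c \<noteq> u"
      using c(1) in_arcsD2 no_loops' T(2) by (auto simp: E_def)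
    ultimately show "\<exists>c\<in>V. c \<noteq> u \<and> (u, c, v) \<in> C \<and> (u, c, w) \<in> C"
      using V mem by blast
  next
    fix u v w z assume V: "u \<in> V" "v \<in> V" "w \<in> V" "z \<in> V"
    show "(u, w, z) \<in> C" if "(u, v, w) \<in> C \<and> (v, w, z) \<in> C \<and> v \<noteq> w"
      using that separates_outer[OF sym conn[OF V(1,3)], of v z] mem V by blast
    show "(v, w, z) \<in> C" if "(u, v, w) \<in> C \<and> (u, w, z) \<in> C"
      using that separates_inner[OF conn[OF V(1,3)], of v z] mem V by blast
  qed
next
  assume ax: ?axioms
  have in_V: "u \<in> V \<and> v \<in> V \<and> w \<in> V" if "(u, v, w) \<in> C" for u v w
    using that assms(3) by auto
  interpret between V C
  proof
    show "(u, v, w) \<in> C \<Longrightarrow> (w, v, u) \<in> C" for u v w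
      using ax in_V by metis
    show "(u, v, w) \<in> C \<Longrightarrow> (v, w, z) \<in> C \<Longrightarrow> v \<noteq> w \<Longrightarrow> (u, w, z) \<in> C" for u v w z
      using ax in_V by metis
    show "(u, v, w) \<in> C \<Longrightarrow> (u, w, z) \<in> C \<Longrightarrow> (v, w, z) \<in> C" for u v w z
      using ax in_V by metis
    show "noncollinear V C u v w \<Longrightarrow> \<exists>c. c \<noteq> u \<and> (u, c, v) \<in> C \<and> (u, c, w) \<in> C" for u v w
      using ax unfolding noncollinear_def by metis
    \<comment> \<open>This is T5 read from right to left, with both of its first two points equal to
      \<open>u\<close>.\<close>
    show "u \<in> V \<Longrightarrow> w \<in> V \<Longrightarrow> (u, u, w) \<in> C" for u w
      using ax by metis
    show "(u, v, w) \<in> C \<Longrightarrow> (v, u, w) \<in> C \<Longrightarrow> u = v" for u v w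
      using ax in_V by metis
  qed (use assms in auto)
  show "tree_betweenness V C"
    using assms(2) by (rule tree_betweenness)
qed

end
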